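(* Let $E\subset\mathbb{C}^*$ be connected. Then $E$ is a $\mathbb{C}^*$-spider's web if and only if $E$ separates each point of $\mathbb{C}^*$ from $\{0,\infty\}$.
   Context: $\mathbb{C}^* := \mathbb{C}\setminus\{0\}$ and $\widehat{\mathbb{C}} := \mathbb{C}\cup\{\infty\}$. Boundaries are taken in $\mathbb{C}$ unless otherwise stated. A set $X\subset\mathbb{C}^*$ is bounded in $\mathbb{C}^*$ if its closure in $\widehat{\mathbb{C}}$ does not meet $\{0,\infty\}$. $\mathbb{C}^*$-spider's web: a set $E\subset\mathbb{C}^*$ is a $\mathbb{C}^*$-spider's web if $E$ is connected and there exists a sequence of domains $(G_n')_{n\in\mathbb{N}}$, each bounded in $\mathbb{C}^*$, such that (a) each $G_n'$ is doubly connected and separates $0$ from $\infty$ (so $\widehat{\mathbb{C}}\setminus G_n'$ has exactly two components, one containing $0$ and the other containing $\infty$); (b) $G_n'\subset G_{n+1}'$ and $\partial G_n'\subset E$ for $n\in\mathbb{N}$; (c) $\bigcup_{n\in\mathbb{N}}G_n'=\mathbb{C}^*$. Separation: for $E,X,Y\subset\widehat{\mathbb{C}}$, $E$ separates $Y$ from $X$ if there is an open set $U$ containing $Y$ such that the closure of $U$ in $\widehat{\mathbb{C}}$ does not meet $X$ and $\partial U\subset E$. If $Y=\{z\}$ one says that $E$ separates $z$ from $X$. *)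

theory Defs
  imports "HOL-Analysis.Analysis"
begin

text \<open>The Riemann sphere is the one-point compactification of the plane: \<open>Some z\<close> is the
  finite point \<open>z\<close> and \<open>None\<close> is the point at infinity.\<close>

definition riemann_sphere :: "complex option topology" where
  "riemann_sphere = Alexandroff_compactification (euclidean :: complex topology)"

definition bounded_in_Cstar :: "complex set \<Rightarrow> bool" where
  "bounded_in_Cstar X \<longleftrightarrow>
     X \<subseteq> - {0} \<and> (riemann_sphere closure_of (Some ` X)) \<inter> {Some 0, None} = {}"

definition domain_in_Cstar :: "complex set \<Rightarrow> bool" where
  "domain_in_Cstar G \<longleftrightarrow> G \<subseteq> - {0} \<and> G \<noteq> {} \<and> open G \<and> connected G"

definition complementary_components :: "complex set \<Rightarrow> complex option set set" where
  "complementary_components G =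
     connected_components_of (subtopology riemann_sphere (- (Some ` G)))"

definition doubly_connected :: "complex set \<Rightarrow> bool" where
  "doubly_connected G \<longleftrightarrow> card (complementary_components G) = 2"

definition separates_zero_from_infinity :: "complex set \<Rightarrow> bool" where
  "separates_zero_from_infinity G \<longleftrightarrow>
     (\<exists>A\<in>complementary_components G. \<exists>B\<in>complementary_components G.
        A \<noteq> B \<and> Some 0 \<in> A \<and> None \<in> B)"

definition Cstar_spiders_web :: "complex set \<Rightarrow> bool" where
  "Cstar_spiders_web E \<longleftrightarrow>
     E \<subseteq> - {0} \<and> connected E \<and>
     (\<exists>G :: nat \<Rightarrow> complex set.
        (\<forall>n. domain_in_Cstar (G n) \<and> bounded_in_Cstar (G n)) \<and>
        (\<forall>n. doubly_connected (G n) \<and> separates_zero_from_infinity (G n)) \<and>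
        (\<forall>n. G n \<subseteq> G (Suc n) \<and> frontier (G n) \<subseteq> E) \<and>
        (\<Union>n. G n) = - {0})"

text \<open>Boundaries are taken in the plane, also for subsets of the sphere: the boundary of
  \<open>U\<close> is that of its finite part \<open>Some -` U\<close>, so infinity is never a boundary point.\<close>

definition separates_from :: "complex option set \<Rightarrow> complex option set \<Rightarrow> complex option set \<Rightarrow> bool"
    (\<open>(_ separates _ from _)\<close> [51, 51, 51] 50) where
  "E separates Y from X \<longleftrightarrow>
     (\<exists>U. openin riemann_sphere U \<and> Y \<subseteq> U \<and>
        (riemann_sphere closure_of U) \<inter> X = {} \<and>
        Some ` frontier (Some -` U) \<subseteq> E)"

end

theory Submission
  imports Defs
begin

text \<open>Compactness lets finitely many separating neighbourhoods cover a closed annulus about \<open>0\<close>;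
  the component of their union that contains the annulus is a domain whose boundary lies in
  \<open>E\<close>. Filling in every complementary component other than those of \<open>0\<close> and \<open>\<infinity>\<close> keeps the
  domain connected and only removes boundary points, so it yields a doubly connected domain.
  Iterating with ever larger annuli gives the spider's web; conversely the domains of a web are
  themselves separating neighbourhoods.\<close>

section \<open>Connected components and closed partitions\<close>

text \<open>Each set is the complement of the other, hence clopen, and a connected set meeting a
  clopen set lies inside it. So each is a full component, and any further component would overlap
  one of them.\<close>

lemma connected_components_of_two_closed:
  assumes "closedin X A" "closedin X B" "connectedin X A" "connectedin X B"
    and "A \<noteq> {}" "B \<noteq> {}" "A \<inter> B = {}" "A \<union> B = topspace X"
  shows "connected_components_of X = {A, B}"
proof -
  have comp: "C \<in> connected_components_of X"
    if "closedin X C" "closedin X D" "connectedin X C" "C \<noteq> {}" "C \<inter> D = {}" "C \<union> D = topspace X"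
    for C D
  proof -
    obtain x where x: "x \<in> C"
      using \<open>C \<noteq> {}\<close> by blast
    have "openin X C"
    proof -
      have "topspace X - D = C"
        using that by blast
      then show ?thesis
        using that(2) by (metis openin_diff openin_topspace)
    qed
    then have "C' \<subseteq> C" if "x \<in> C'" "connectedin X C'" for C'
      using connectedin_clopen_cases[of X C' C] \<open>closedin X C\<close> that x by (auto simp: disjnt_iff)
    then have "connected_component_of_set X x = C"
      using connected_component_of_unique[of x C X] x that by blast
    then show ?thesis
      using connected_component_in_connected_components_of[of X x] x closedin_subset[OF that(1)]
      by auto
  qed
  have A: "A \<in> connected_components_of X" and B: "B \<in> connected_components_of X"
    using comp[of A B] comp[of B A] assms by (simp_all add: Int_commute Un_commute)
  have "C = A \<or> C = B" if C: "C \<in> connected_components_of X" for C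
  proof -
    have "C \<inter> A \<noteq> {} \<or> C \<inter> B \<noteq> {}"
      using nonempty_connected_components_of[OF C] connected_components_of_subset[OF C] assms(8)
      by blast
    then show ?thesis
      using connected_components_of_overlap[OF C A] connected_components_of_overlap[OF C B] by blast
  qed
  with A B show ?thesis
    by blast
qed

section \<open>The Riemann sphere and boundedness in the punctured plane\<close>

lemma topspace_riemann_sphere [simp]: "topspace riemann_sphere = UNIV"
  by (auto simp: riemann_sphere_def) (metis not_Some_eq rangeI)

lemma open_vimage_Some:
  assumes "openin riemann_sphere U"
  shows "open (Some -` U)"
  using continuous_map_Some[of euclidean] assms
  by (auto simp: riemann_sphere_def continuous_map_def vimage_def)

text \<open>A neighbourhood of 0 missing \<open>X\<close> yields the inner radius; one of infinity
  is the complement of a compact set, whose bound is the outer radius. Conversely, a closed annulus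
  is compact, so its image is closed in the sphere and contains the closure of
  \<open>X\<close>.\<close>

lemma riemann_sphere_closure_disjoint_iff:
  "(riemann_sphere closure_of X) \<inter> {Some 0, None} = {} \<longleftrightarrow>
     (\<exists>r>0. \<exists>R. X \<subseteq> Some ` {z. r \<le> norm z \<and> norm z \<le> R})"
    (is "?lhs \<longleftrightarrow> ?rhs")
proof
  assume L: ?lhs
  then obtain T where T: "openin riemann_sphere T" "Some 0 \<in> T" "T \<inter> X = {}"
    by (auto simp: in_closure_of)
  then obtain r where r: "r > 0" "ball 0 r \<subseteq> Some -` T"
    using open_vimage_Some[OF T(1)] by (meson open_contains_ball vimageI)
  from L obtain V where V: "openin riemann_sphere V" "None \<in> V" "V \<inter> X = {}"
    by (auto simp: in_closure_of)
  then obtain K where K: "compact K" "V = insert None (Some ` (- K))"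
    by (auto simp: riemann_sphere_def openin_Alexandroff_compactification Compl_eq_Diff_UNIV)
  obtain R where R: "\<And>x. x \<in> K \<Longrightarrow> norm x \<le> R"
    using compact_imp_bounded[OF K(1)] by (auto simp: bounded_iff)
  have "X \<subseteq> Some ` {z. r \<le> norm z \<and> norm z \<le> R}"
  proof
    fix x assume x: "x \<in> X"
    then obtain z where z: "x = Some z"
      using V by (cases x) auto
    have "z \<in> K"
      using x z V(3) K(2) by auto
    moreover have "z \<notin> ball 0 r"
      using r(2) x z T(3) by auto
    ultimately show "x \<in> Some ` {z. r \<le> norm z \<and> norm z \<le> R}"
      using z R by auto
  qed
  with r(1) show ?rhs by blast
next
  assume ?rhs
  then obtain r R where rR: "r > 0" "X \<subseteq> Some ` {z. r \<le> norm z \<and> norm z \<le> R}"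
    by blast
  have "{z::complex. r \<le> norm z \<and> norm z \<le> R} = cball 0 R - ball 0 r"
    by auto
  then have "compact {z::complex. r \<le> norm z \<and> norm z \<le> R}"
    by (simp add: compact_diff)
  then have "closedin riemann_sphere (Some ` {z. r \<le> norm z \<and> norm z \<le> R})"
    by (simp add: riemann_sphere_def compact_imp_closed)
  then have "riemann_sphere closure_of X \<subseteq> Some ` {z. r \<le> norm z \<and> norm z \<le> R}"
    by (rule closure_of_minimal[OF rR(2)])
  then show ?lhs
    using rR(1) by force
qed

text \<open>Reduces boundedness to norm estimates, the form used from here on. A positive inner
  radius already excludes 0, which accounts for the inclusion in the definition.\<close>

lemma bounded_in_Cstar_iff:
  "bounded_in_Cstar X \<longleftrightarrow> (\<exists>r>0. \<exists>R. \<forall>z\<in>X. r \<le> norm z \<and> norm z \<le> R)"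
    (is "_ \<longleftrightarrow> ?rhs")
proof -
  have "(\<exists>r>0. \<exists>R. Some ` X \<subseteq> Some ` {z. r \<le> norm z \<and> norm z \<le> R}) \<longleftrightarrow> ?rhs"
    unfolding inj_image_subset_iff[OF inj_Some] by (simp only: subset_eq mem_Collect_eq)
  moreover have "X \<subseteq> - {0}" if ?rhs
  proof -
    obtain r R where "r > 0" "\<forall>z\<in>X. r \<le> norm z \<and> norm z \<le> R"
      using \<open>?rhs\<close> by blast
    then show ?thesis
      by auto
  qed
  ultimately show ?thesis
    unfolding bounded_in_Cstar_def riemann_sphere_closure_disjoint_iff by argo
qed

section \<open>Complementary components and filling of holes\<close>

text \<open>In the sphere, the complement of the domain splits into the image of \<open>K\<close>
  and the image of \<open>L\<close> with infinity added. Both are closed and connected, so they are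
  exactly the components.\<close>

lemma complementary_components_Compl_Un:
  assumes "compact K" "connected K" "K \<noteq> {}"
    and "closed L" "connected L" "\<not> bounded L" "K \<inter> L = {}"
  shows "complementary_components (- (K \<union> L)) = {Some ` K, insert None (Some ` L)}"
proof -
  let ?A = "Some ` K" and ?B = "insert None (Some ` L)"
  have compl: "- Some ` (- (K \<union> L)) = ?A \<union> ?B"
  proof (rule set_eqI)
    fix x show "x \<in> - Some ` (- (K \<union> L)) \<longleftrightarrow> x \<in> ?A \<union> ?B"
      by (cases x) auto
  qed
  have A: "closedin riemann_sphere ?A"
    using assms by (simp add: riemann_sphere_def compact_imp_closed)
  have B: "closedin riemann_sphere ?B"
  proof -
    have "?B = topspace riemann_sphere - Some ` (- L)"
    proof (rule set_eqI)
      fix x show "x \<in> ?B \<longleftrightarrow> x \<in> topspace riemann_sphere - Some ` (- L)"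
        by (cases x) auto
    qed
    moreover have "openin riemann_sphere (Some ` (- L))"
      using assms(4) by (simp add: riemann_sphere_def open_Compl)
    ultimately show ?thesis
      by (metis closedin_diff closedin_topspace)
  qed
  have cS: "connectedin riemann_sphere (Some ` S)" if "connected S" for S
    using connectedin_continuous_map_image[OF continuous_map_Some[of euclidean]] that
    by (simp add: riemann_sphere_def connectedin_iff_connected)
  \<comment> \<open>An unbounded set lies in no compact set, so it meets every neighbourhood of
    infinity. Hence adding infinity to \<open>L\<close> keeps it connected.\<close>
  have "None \<in> riemann_sphere closure_of (Some ` L)"
  proof (rule ccontr)
    assume "\<not> ?thesis"
    then obtain V where V: "openin riemann_sphere V" "None \<in> V" "V \<inter> Some ` L = {}"
      by (auto simp: in_closure_of)
    then obtain C where "compact C" "V = insert None (Some ` (- C))"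
      by (auto simp: riemann_sphere_def openin_Alexandroff_compactification Compl_eq_Diff_UNIV)
    then have "L \<subseteq> C"
      using V(3) by auto
    then show False
      using \<open>compact C\<close> assms(6) bounded_subset compact_imp_bounded by blast
  qed
  then have cB: "connectedin riemann_sphere ?B"
    using closure_of_subset[of "Some ` L" riemann_sphere]
    by (intro connectedin_intermediate_closure_of[OF cS[OF assms(5)]]) auto
  show ?thesis
    unfolding complementary_components_def compl
  proof (rule connected_components_of_two_closed)
    show "?A \<inter> ?B = {}"
      using assms(7) by auto
  qed (use A B cS[OF assms(2)] cB assms(3) in
      \<open>auto simp: connectedin_subtopology intro!: closedin_subset_topspace\<close>)
qed

text \<open>The circle inside \<open>U\<close> keeps the complementary component of 0 apart from the
  unbounded one. Taking the complement of these two adds all other holes to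
  \<open>U\<close>.\<close>

lemma annulus_domain_fill:
  fixes U :: "complex set"
  assumes U: "open U" "connected U" "bounded_in_Cstar U" and s: "s > 0" "sphere 0 s \<subseteq> U"
  shows "\<exists>G. U \<subseteq> G \<and> domain_in_Cstar G \<and> bounded_in_Cstar G \<and> doubly_connected G \<and>
           separates_zero_from_infinity G \<and> frontier G \<subseteq> frontier U"
proof -
  obtain r R where r: "r > 0" and rR: "\<And>z. z \<in> U \<Longrightarrow> r \<le> norm z \<and> norm z \<le> R"
    using U(3) by (auto simp: bounded_in_Cstar_iff)
  \<comment> \<open>A finite stand-in for infinity: \<open>p\<close> lies beyond radius
    \<open>R\<close>, so its component \<open>L\<close> in the complement of \<open>U\<close>
    contains the whole exterior of the disc. The absolute value gives the norm of \<open>p\<close>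
    without a case split on the sign of \<open>R\<close>.\<close>
  define p where "p = complex_of_real (\<bar>R\<bar> + 1)"
  have p: "norm p = \<bar>R\<bar> + 1"
    unfolding p_def norm_of_real by simp
  define K where "K = connected_component_set (- U) 0"
  define L where "L = connected_component_set (- U) p"
  define G where "G = - (K \<union> L)"
  have "0 \<notin> U" "p \<notin> U"
    using rR[of 0] rR[of p] r p by auto
  then have KL: "K \<in> components (- U)" "L \<in> components (- U)"
    by (auto simp: K_def L_def intro: componentsI)
  have mem: "0 \<in> K" "p \<in> L"
    using \<open>0 \<notin> U\<close> \<open>p \<notin> U\<close> by (auto simp: K_def L_def)
  note sub = in_components_subset[OF KL(1)] in_components_subset[OF KL(2)]
  note conn = in_components_connected[OF KL(1)] in_components_connected[OF KL(2)]
  have closed: "closed K" "closed L"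
    using closed_components KL U(1) by blast+
  have "ball 0 r \<subseteq> - U"
    using rR by force
  then have ballK: "ball 0 r \<subseteq> K"
    unfolding K_def using r by (intro connected_component_maximal) auto
  have "- cball 0 R \<subseteq> - U"
    using rR by force
  moreover have "connected (- cball 0 R :: complex set)"
    by (intro connected_complement_bounded_convex) auto
  ultimately have cballL: "- cball 0 R \<subseteq> L"
    unfolding L_def using p by (intro connected_component_maximal) auto
  have unbL: "\<not> bounded L"
  proof
    assume "bounded L"
    then have "bounded (L \<union> cball 0 R)"
      by simp
    moreover have "L \<union> cball 0 R = UNIV"
      using cballL by auto
    ultimately show False
      using not_bounded_UNIV by metis
  qed
  \<comment> \<open>Neither connected set can cross the circle. \<open>K\<close> contains 0, so it
    stays inside; \<open>L\<close> is unbounded, so it stays outside.\<close>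
  have sph: "K \<inter> frontier (ball 0 s) = {}" "L \<inter> frontier (ball 0 s) = {}"
    using sub s by (auto simp: frontier_ball)
  have K_ball: "K \<subseteq> ball 0 s"
    using connected_Int_frontier[OF conn(1), of "ball 0 s"] sph mem s by fastforce
  have "L \<inter> ball 0 s = {}"
  proof (rule ccontr)
    assume "L \<inter> ball 0 s \<noteq> {}"
    then have "L \<subseteq> ball 0 s"
      using connected_Int_frontier[OF conn(2), of "ball 0 s"] sph by fastforce
    then show False
      using unbL bounded_subset bounded_ball by blast
  qed
  with K_ball have disj: "K \<inter> L = {}"
    by blast
  have "compact K"
    using closed(1) K_ball bounded_subset[OF bounded_ball] by (auto simp: compact_eq_bounded_closed)
  then have comps: "complementary_components G = {Some ` K, insert None (Some ` L)}"
    unfolding G_def using complementary_components_Compl_Un[of K L] conn closed mem unbL disj by auto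
  have neq: "Some ` K \<noteq> insert None (Some ` L)"
    by auto
  have "U \<subseteq> G"
    using sub by (auto simp: G_def)
  moreover have "connected G"
  proof -
    \<comment> \<open>Removing a component of the complement of a connected set leaves a connected
      set. \<open>K\<close> is removed from the plane first; \<open>L\<close>, being disjoint from
      \<open>K\<close>, is still a component of \<open>- K - U\<close> and can be removed
      next.\<close>
    have "connected (- K)"
      using component_complement_connected U(2) KL(1) by blast
    moreover have "L \<in> components (- K - U)"
      using KL(2) disj unfolding in_components_maximal by blast
    ultimately have "connected (- K - L)"
      using component_diff_connected[OF U(2), of "- K" L] sub by blast
    moreover have "- K - L = G"
      by (auto simp: G_def)
    ultimately show ?thesis
      by simp
  qed
  moreover have "0 \<notin> G" "open G"
    using mem closed by (auto simp: G_def open_Compl)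
  moreover have "G \<noteq> {}"
  proof -
    have "complex_of_real s \<in> sphere 0 s"
      using s(1) by simp
    then show ?thesis
      using s(2) \<open>U \<subseteq> G\<close> by blast
  qed
  moreover have "bounded_in_Cstar G"
    unfolding bounded_in_Cstar_iff G_def using r ballK cballL
    by (intro exI[of _ r] conjI exI[of _ R]) (force simp: subset_iff)+
  moreover have "doubly_connected G"
    using neq by (simp add: doubly_connected_def comps)
  moreover have "separates_zero_from_infinity G"
    unfolding separates_zero_from_infinity_def comps using neq mem by auto
  moreover have "frontier G \<subseteq> frontier U"
  proof -
    \<comment> \<open>A set and its complement share their boundary, and the boundary of a component
      lies in that of the whole set.\<close>
    have "frontier G \<subseteq> frontier K \<union> frontier L"
      unfolding G_def frontier_complement by (rule frontier_Un_subset)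
    then show ?thesis
      using frontier_of_components_subset[OF KL(1)] frontier_of_components_subset[OF KL(2)]
      by (auto simp: frontier_complement)
  qed
  ultimately show ?thesis
    by (auto simp: domain_in_Cstar_def)
qed

section \<open>Separation expressed in the plane, and finite unions\<close>

text \<open>The closure condition keeps infinity out of the neighbourhood, so nothing is lost by
  passing to its finite part. Conversely, \<open>Some\<close> maps open plane sets to open sets of
  the sphere.\<close>

lemma separates_point_iff:
  "(Some ` E) separates {Some z} from {Some 0, None} \<longleftrightarrow>
     (\<exists>U. open U \<and> z \<in> U \<and> bounded_in_Cstar U \<and> frontier U \<subseteq> E)"
    (is "?lhs \<longleftrightarrow> ?rhs")
proof
  assume ?lhs
  then obtain U where U: "openin riemann_sphere U" "Some z \<in> U"
      "(riemann_sphere closure_of U) \<inter> {Some 0, None} = {}" "frontier (Some -` U) \<subseteq> E"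
    unfolding separates_from_def inj_image_subset_iff[OF inj_Some] by blast
  have "open (Some -` U)"
    by (rule open_vimage_Some[OF U(1)])
  moreover have "bounded_in_Cstar (Some -` U)"
  proof -
    obtain r R where "r > 0" "U \<subseteq> Some ` {z. r \<le> norm z \<and> norm z \<le> R}"
      using U(3) unfolding riemann_sphere_closure_disjoint_iff by blast
    then have "\<forall>z\<in>Some -` U. r \<le> norm z \<and> norm z \<le> R"
      by blast
    then show ?thesis
      unfolding bounded_in_Cstar_iff using \<open>r > 0\<close> by blast
  qed
  ultimately show ?rhs
    using U by blast
next
  assume ?rhs
  then obtain U where U: "open U" "z \<in> U" "bounded_in_Cstar U" "frontier U \<subseteq> E"
    by blast
  show ?lhs
    unfolding separates_from_def
  proof (intro exI[of _ "Some ` U"] conjI)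
    show "openin riemann_sphere (Some ` U)"
      using U(1) by (simp add: riemann_sphere_def)
    show "(riemann_sphere closure_of Some ` U) \<inter> {Some 0, None} = {}"
      using U(3) by (simp add: bounded_in_Cstar_def)
    show "{Some z} \<subseteq> Some ` U"
      using U(2) by simp
    show "Some ` frontier (Some -` Some ` U) \<subseteq> Some ` E"
      using U(4) by (simp add: inj_vimage_image_eq image_mono)
  qed
qed

lemma bounded_in_Cstar_Un:
  assumes "bounded_in_Cstar A" "bounded_in_Cstar B"
  shows "bounded_in_Cstar (A \<union> B)"
proof -
  obtain r R where A: "r > 0" "\<And>z. z \<in> A \<Longrightarrow> r \<le> norm z \<and> norm z \<le> R"
    using assms(1) by (auto simp: bounded_in_Cstar_iff)
  obtain r' R' where B: "r' > 0" "\<And>z. z \<in> B \<Longrightarrow> r' \<le> norm z \<and> norm z \<le> R'"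
    using assms(2) by (auto simp: bounded_in_Cstar_iff)
  have "\<forall>z\<in>A \<union> B. min r r' \<le> norm z \<and> norm z \<le> max R R'"
    using A(2) B(2) by (auto simp: min_le_iff_disj le_max_iff_disj)
  moreover have "min r r' > 0"
    using A(1) B(1) by simp
  ultimately show ?thesis
    unfolding bounded_in_Cstar_iff by blast
qed

lemma bounded_in_Cstar_Union:
  "finite F \<Longrightarrow> (\<And>U. U \<in> F \<Longrightarrow> bounded_in_Cstar U) \<Longrightarrow> bounded_in_Cstar (\<Union>F)"
proof (induction F rule: finite_induct)
  case empty
  show ?case
    unfolding bounded_in_Cstar_iff by (rule exI[of _ 1]) simp
next
  case (insert U F)
  then show ?case
    by (simp add: bounded_in_Cstar_Un)
qed

section \<open>A doubly connected domain around a bounded set\<close>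

lemma exists_doubly_connected_domain:
  assumes sep: "\<And>z. z \<noteq> 0 \<Longrightarrow> \<exists>U. open U \<and> z \<in> U \<and> bounded_in_Cstar U \<and> frontier U \<subseteq> E"
    and X: "bounded_in_Cstar X"
  shows "\<exists>G. X \<subseteq> G \<and> domain_in_Cstar G \<and> bounded_in_Cstar G \<and> doubly_connected G \<and>
           separates_zero_from_infinity G \<and> frontier G \<subseteq> E"
proof -
  obtain r R0 where r: "r > 0" "\<And>z. z \<in> X \<Longrightarrow> r \<le> norm z \<and> norm z \<le> R0"
    using X by (auto simp: bounded_in_Cstar_iff)
  \<comment> \<open>The maximum ensures that the annulus contains the circle of radius
    \<open>r\<close>, even when \<open>X\<close> is empty and \<open>R0\<close> is smaller than
    \<open>r\<close>. That circle is later passed to \<open>annulus_domain_fill\<close>.\<close>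
  define R where "R = max r R0"
  define A where "A = {z::complex. r \<le> norm (z - 0) \<and> norm (z - 0) \<le> R}"
  have A: "connected A"
    unfolding A_def by (rule connected_annulus) simp
  have "A = cball 0 R - ball 0 r"
    by (auto simp: A_def)
  then have "compact A"
    by (simp add: compact_diff)
  have "\<forall>z\<in>A. \<exists>U. open U \<and> z \<in> U \<and> bounded_in_Cstar U \<and> frontier U \<subseteq> E"
  proof
    fix z assume "z \<in> A"
    then have "z \<noteq> 0"
      using r(1) by (auto simp: A_def)
    then show "\<exists>U. open U \<and> z \<in> U \<and> bounded_in_Cstar U \<and> frontier U \<subseteq> E"
      by (rule sep)
  qed
  then obtain N where N: "\<forall>z\<in>A. open (N z) \<and> z \<in> N z \<and> bounded_in_Cstar (N z) \<and> frontier (N z) \<subseteq> E"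
    unfolding bchoice_iff by blast
  then have "\<And>z. z \<in> A \<Longrightarrow> open (N z)"
    by blast
  moreover have "A \<subseteq> (\<Union>z\<in>A. N z)"
    using N by blast
  ultimately obtain D where D: "D \<subseteq> A" "finite D" "A \<subseteq> (\<Union>z\<in>D. N z)"
    by (rule compactE_image[OF \<open>compact A\<close>])
  define W where "W = \<Union>(N ` D)"
  have W: "open W"
    using D N by (auto simp: W_def)
  have bW: "bounded_in_Cstar W"
    unfolding W_def using D N by (intro bounded_in_Cstar_Union) auto
  \<comment> \<open>Finiteness of the subcover is essential: an infinite union may acquire boundary
    points lying on none of the individual boundaries.\<close>
  have "frontier W \<subseteq> (\<Union>t\<in>N ` D. frontier t)"
    unfolding W_def using D by (intro frontier_Union_subset) auto
  then have fW: "frontier W \<subseteq> E"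
    using D N by blast
  have rA: "of_real r \<in> A"
    using r(1) by (auto simp: A_def R_def)
  \<comment> \<open>\<open>W\<close> may be disconnected. The connected annulus lies in a single
    component, and passing to it adds no boundary points.\<close>
  define U where "U = connected_component_set W (of_real r)"
  have UW: "U \<in> components W"
    using rA D by (auto simp: U_def W_def intro!: componentsI)
  have AU: "A \<subseteq> U"
    unfolding U_def using rA A D by (intro connected_component_maximal) (auto simp: W_def)
  have "sphere 0 r \<subseteq> U"
    using AU by (auto simp: A_def R_def)
  moreover have "open U" "connected U"
    using W UW by (auto simp: open_components in_components_connected)
  moreover have "bounded_in_Cstar U"
    using bW in_components_subset[OF UW] unfolding bounded_in_Cstar_iff by blast
  ultimately obtain G where G: "U \<subseteq> G" "domain_in_Cstar G" "bounded_in_Cstar G" "doubly_connected G"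
      "separates_zero_from_infinity G" "frontier G \<subseteq> frontier U"
    using annulus_domain_fill[of U r] r(1) by blast
  have "X \<subseteq> A"
    using r by (auto simp: A_def R_def le_max_iff_disj)
  moreover have "frontier G \<subseteq> E"
    using G(6) frontier_of_components_subset[OF UW] fW by blast
  ultimately show ?thesis
    using G AU by blast
qed

section \<open>The equivalence and the exhausting sequence\<close>

theorem theorem1p4:
  fixes E :: "complex set"
  assumes "E \<subseteq> - {0}" and "connected E"
  shows "Cstar_spiders_web E \<longleftrightarrow>
           (\<forall>z \<in> - {0}. (Some ` E) separates {Some z} from {Some 0, None})"
proof
  assume "Cstar_spiders_web E"
  then obtain G :: "nat \<Rightarrow> complex set" where
      G: "\<forall>n. domain_in_Cstar (G n) \<and> bounded_in_Cstar (G n)"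
        "\<forall>n. G n \<subseteq> G (Suc n) \<and> frontier (G n) \<subseteq> E" "(\<Union>n. G n) = - {0}"
    unfolding Cstar_spiders_web_def by (elim conjE exE) (rule that)
  show "\<forall>z \<in> - {0}. (Some ` E) separates {Some z} from {Some 0, None}"
  proof
    fix z :: complex assume "z \<in> - {0}"
    then obtain n where "z \<in> G n"
      using G(3) by blast
    moreover have "open (G n)"
      using G(1) by (simp add: domain_in_Cstar_def)
    ultimately show "(Some ` E) separates {Some z} from {Some 0, None}"
      unfolding separates_point_iff using G(1,2) by blast
  qed
next
  assume R: "\<forall>z \<in> - {0}. (Some ` E) separates {Some z} from {Some 0, None}"
  \<comment> \<open>The prescribed annuli force the domains to exhaust the punctured plane;
    \<open>Suc n\<close> keeps the inner radius positive at \<open>n = 0\<close>.\<close>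
  let ?P = "\<lambda>n G. domain_in_Cstar G \<and> bounded_in_Cstar G \<and> doubly_connected G \<and>
      separates_zero_from_infinity G \<and> frontier G \<subseteq> E \<and>
      {z. 1 / real (Suc n) \<le> norm z \<and> norm z \<le> real (Suc n)} \<subseteq> G"
  have step: "\<exists>G. X \<subseteq> G \<and> ?P n G" if "bounded_in_Cstar X" for X n
  proof -
    let ?A = "{z::complex. 1 / real (Suc n) \<le> norm z \<and> norm z \<le> real (Suc n)}"
    have "bounded_in_Cstar ?A"
      unfolding bounded_in_Cstar_iff
      by (intro exI[of _ "1 / real (Suc n)"] exI[of _ "real (Suc n)"] conjI) auto
    with that have "bounded_in_Cstar (X \<union> ?A)"
      by (rule bounded_in_Cstar_Un)
    moreover have "\<exists>U. open U \<and> z \<in> U \<and> bounded_in_Cstar U \<and> frontier U \<subseteq> E" if "z \<noteq> 0" for z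
      using R that unfolding separates_point_iff by blast
    ultimately show ?thesis
      using exists_doubly_connected_domain[of E "X \<union> ?A"] by (simp only: Un_subset_iff) blast
  qed
  \<comment> \<open>The domain just chosen is bounded in the punctured plane, so it can serve as
    \<open>X\<close> for the next one; this makes the sequence increasing.\<close>
  have "\<exists>G. \<forall>n. ?P n (G n) \<and> G n \<subseteq> G (Suc n)"
  proof (rule dependent_nat_choice)
    show "\<exists>G. ?P 0 G"
      \<comment> \<open>The recursion starts from the empty set, written as an empty union so that
        its boundedness is an instance of the lemma on finite unions.\<close>
      using step[of "\<Union>{}" 0] bounded_in_Cstar_Union[of "{}"] by blast
    show "\<exists>H. ?P (Suc n) H \<and> G \<subseteq> H" if "?P n G" for G n
      using step[of G "Suc n"] that by blast
  qed
  then obtain G where G: "\<And>n. ?P n (G n)" "\<And>n. G n \<subseteq> G (Suc n)"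
    by blast
  have "(\<Union>n. G n) = - {0}"
  proof (intro equalityI subsetI)
    fix z assume "z \<in> (\<Union>n. G n)"
    then show "z \<in> - {0}"
      using G(1) by (auto simp: domain_in_Cstar_def)
  next
    fix z :: complex assume "z \<in> - {0}"
    then have z: "norm z > 0"
      by simp
    \<comment> \<open>Exceeding both the norm and its reciprocal places \<open>z\<close> between the
      two radii of the annulus with index \<open>n\<close>.\<close>
    obtain n where n: "max (norm z) (1 / norm z) < real n"
      using reals_Archimedean2 by blast
    then have "norm z \<le> real (Suc n)" "1 / norm z \<le> real (Suc n)"
      by auto
    moreover from this have "1 / real (Suc n) \<le> norm z"
      using z by (simp add: field_simps)
    ultimately show "z \<in> (\<Union>n. G n)"
      using G(1)[of n] by blast
  qed
  then show "Cstar_spiders_web E"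
    unfolding Cstar_spiders_web_def using assms G by (intro conjI exI[of _ G] allI) simp_all
qed

end
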